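(* Let $q\ge 2$ and $c\ge 1$ be integers and let $\kappa>0$. Consider a (symmetric) colluder strategy with parametrization $\Psi_b(\vec{x})$ that belongs to Class 3, i.e. there is a function $W$ with $W(b,z)\in\{0,1\}$ and $W(b,z)+W(z,b)=1$ for $b\neq z$, and $W(b,0)=1$ for $b\ge 1$, such that for every $b\in\{1,\dots,c\}$ and every $\vec{x}\in\mathbb{N}^{q-1}$ with $\sum_\beta x_\beta=c-b$, $$\Psi_b(\vec{x})=\frac{1}{\ell+1}\prod_{k=1}^{r}W(b,z_k),$$ where $\ell$ is the number of entries of $\vec{x}$ equal to $b$, $r=q-1-\ell$, and $z_1,\dots,z_r$ are the entries of $\vec{x}$ different from $b$. Let $b\in\{1,\dots,c\}$, and let $N_b\in\mathbb{N}$ satisfy $N_b>\max\{c-b,\;|c-bq|,\;(c-b)(q-2)\}$. Let $\tau_b= e^{i2\pi/N_b}$, and for integers $a\in\{0,\dots,N_b-1\}$ let $$G_{ba}=\sum_{\substack{z\in\{0,\ldots,c-b\}\setminus\{b\}\\ W(b,z)=1}}\frac{\Gamma(\kappa+z)}{\tau_b^{az}\,z!},\qquad v_{ba}=\frac{\Gamma(\kappa+b)}{\tau_b^{ab}\,b!}.$$ Then $$K_b=\frac{b!\,(c-b)!}{q\,N_b\,\Gamma(\kappa+b)\,\Gamma(c-b+\kappa[q-1])\,B(\kappa\mathbf{1}_{q-1})}\sum_{a=0}^{N_b-1}\tau_b^{ac}\left[\left(G_{ba}+v_{ba}\right)^q-G_{ba}^{\,q}\right].$$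
   Context: $\mathbb{N}$ includes $0$. $\mathcal{Q}$ is an alphabet of size $q$, $c$ is the number of colluders, $\kappa>0$ is a constant. $\mathbf{1}_n=(1,\dots,1)$ has length $n$. For a vector $\vec{v}$ with $n\ge1$ positive entries the generalized Beta function is $B(\vec{v})=\prod_{a=1}^n\Gamma(v_a)\big/\Gamma\big(\sum_{a=1}^n v_a\big)$. For $\vec{x}\in\mathbb{N}^{q-1}$ with entries summing to $c-b$, $\binom{c-b}{\vec{x}}=(c-b)!/\prod_\beta x_\beta!$ is the multinomial coefficient. A colluder strategy is given by probabilities $\theta_{y|\vec{\sigma}}$ (with $\sum_{y\in\mathcal{Q}}\theta_{y|\vec\sigma}=1$) that the colluders output symbol $y\in\mathcal{Q}$, given the vector $\vec{\sigma}\in\mathbb{N}^{q}$ with $\sum_\alpha\sigma_\alpha=c$, where $\sigma_\alpha$ counts the colluders that received symbol $\alpha$; colluders can only output a symbol they received, i.e. $\theta_{y|\vec\sigma}=0$ if $\sigma_y=0$. The strategy is symbol-symmetric: $\theta_{\alpha|\vec\sigma}$ depends on $\alpha$ only through the value $\sigma_\alpha$, and is invariant under permutation of the other components of $\vec\sigma$. Hence one can define $\Psi_b(\vec{x})=\theta_{\alpha|\vec{\sigma}}$ where $\sigma_\alpha=b$ and $\vec{x}\in\mathbb{N}^{q-1}$ consists of the other components of $\vec\sigma$ (so the entries of $\vec{x}$ sum to $c-b$). The parameters $K_b$ are defined as $$K_b=\sum_{\vec{x}}\mathbb{P}_{q-1}(\vec{x}|b)\,\Psi_b(\vec{x}),\qquad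 \mathbb{P}_{q-1}(\vec{x}|b)=\binom{c-b}{\vec{x}}\frac{B(\kappa\mathbf{1}_{q-1}+\vec{x})}{B(\kappa\mathbf{1}_{q-1})},$$ where the sum is over all $\vec{x}\in\mathbb{N}^{q-1}$ whose entries sum to $c-b$. The function $W(b,z)$ is defined for $b,z\in\{0,\dots,c\}$ with $b\ne z$. *)

theory Defs
  imports "HOL-Analysis.Analysis"
begin

text \<open>
  The alphabet is a finite type \<open>'a\<close>; a tally \<open>\<sigma> :: 'a \<Rightarrow> nat\<close> records how many colluders
  received each symbol. Vectors indexed by positions, such as those in N^(q-1), are lists.
\<close>

definition tallies :: "nat \<Rightarrow> ('a::finite \<Rightarrow> nat) set" where
  "tallies c = {\<sigma>. (\<Sum>\<alpha>\<in>UNIV. \<sigma> \<alpha>) = c}"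

definition strategy :: "nat \<Rightarrow> ('a::finite \<Rightarrow> ('a \<Rightarrow> nat) \<Rightarrow> real) \<Rightarrow> bool" where
  "strategy c \<theta> \<longleftrightarrow> (\<forall>\<sigma>\<in>tallies c.
     (\<forall>y. \<theta> y \<sigma> \<ge> 0) \<and> (\<Sum>y\<in>UNIV. \<theta> y \<sigma>) = 1 \<and> (\<forall>y. \<sigma> y = 0 \<longrightarrow> \<theta> y \<sigma> = 0))"

text \<open>The components of \<open>\<sigma>\<close> other than the one at \<open>\<alpha>\<close>, up to permutation.\<close>

definition others :: "('a::finite \<Rightarrow> nat) \<Rightarrow> 'a \<Rightarrow> nat multiset" where
  "others \<sigma> \<alpha> = image_mset \<sigma> (mset_set (UNIV - {\<alpha>}))"

definition symbol_symmetric :: "nat \<Rightarrow> ('a::finite \<Rightarrow> ('a \<Rightarrow> nat) \<Rightarrow> real) \<Rightarrow> bool" where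
  "symbol_symmetric c \<theta> \<longleftrightarrow> (\<forall>\<sigma>\<in>tallies c. \<forall>\<sigma>'\<in>tallies c. \<forall>\<alpha> \<beta>.
     \<sigma> \<alpha> = \<sigma>' \<beta> \<and> others \<sigma> \<alpha> = others \<sigma>' \<beta> \<longrightarrow> \<theta> \<alpha> \<sigma> = \<theta> \<beta> \<sigma>')"

text \<open>
  Meaningful for symbol-symmetric \<open>\<theta>\<close>, when \<open>x\<close> has one entry fewer than the alphabet and
  \<open>b\<close> together with the entries of \<open>x\<close> sums to \<open>c\<close>; \<open>\<sigma>\<close> is then automatically in \<open>tallies c\<close>.
\<close>

definition Psi :: "('a::finite \<Rightarrow> ('a \<Rightarrow> nat) \<Rightarrow> real) \<Rightarrow> nat \<Rightarrow> nat list \<Rightarrow> real" where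
  "Psi \<theta> b x = (THE p. \<exists>\<alpha> \<sigma>. \<sigma> \<alpha> = b \<and> others \<sigma> \<alpha> = mset x \<and> p = \<theta> \<alpha> \<sigma>)"

lemma sum_eq_others: "(\<Sum>\<beta>\<in>UNIV. \<sigma> \<beta>) = \<sigma> \<alpha> + sum_mset (others \<sigma> \<alpha>)"
  by (simp add: others_def sum.remove [of UNIV \<alpha>] flip: sum_unfold_sum_mset)

lemma Psi_eq:
  assumes "symbol_symmetric c \<theta>" "\<sigma> \<in> tallies c" "others \<sigma> \<alpha> = mset x"
  shows "Psi \<theta> (\<sigma> \<alpha>) x = \<theta> \<alpha> \<sigma>"
proof -
  have "\<theta> \<beta> \<sigma>' = \<theta> \<alpha> \<sigma>" if "\<sigma>' \<beta> = \<sigma> \<alpha>" "others \<sigma>' \<beta> = mset x" for \<beta> \<sigma>'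
  proof -
    have "\<sigma>' \<in> tallies c"
      using assms(2,3) that sum_eq_others[of \<sigma>' \<beta>] sum_eq_others[of \<sigma> \<alpha>]
      by (simp add: tallies_def)
    then show ?thesis
      using assms that unfolding symbol_symmetric_def by metis
  qed
  then show ?thesis
    unfolding Psi_def using assms(3) by (intro the_equality) blast+
qed

definition vecs :: "nat \<Rightarrow> nat \<Rightarrow> nat list set" where
  "vecs n s = {x. length x = n \<and> sum_list x = s}"

definition gen_Beta :: "real list \<Rightarrow> real" where
  "gen_Beta v = prod_list (map Gamma v) / Gamma (sum_list v)"

definition multinomial :: "nat list \<Rightarrow> real" where
  "multinomial x = fact (sum_list x) / prod_list (map fact x)"

definition cond_prob :: "nat \<Rightarrow> real \<Rightarrow> nat list \<Rightarrow> real" where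
  "cond_prob n \<kappa> x =
     multinomial x * gen_Beta (map (\<lambda>k. \<kappa> + real k) x) / gen_Beta (replicate n \<kappa>)"

definition K_par :: "nat \<Rightarrow> nat \<Rightarrow> real \<Rightarrow> (nat \<Rightarrow> nat list \<Rightarrow> real) \<Rightarrow> nat \<Rightarrow> real" where
  "K_par q c \<kappa> \<Psi> b = (\<Sum>x\<in>vecs (q - 1) (c - b). cond_prob (q - 1) \<kappa> x * \<Psi> b x)"

definition class3 ::
    "nat \<Rightarrow> nat \<Rightarrow> (nat \<Rightarrow> nat list \<Rightarrow> real) \<Rightarrow> (nat \<Rightarrow> nat \<Rightarrow> real) \<Rightarrow> bool" where
  "class3 q c \<Psi> W \<longleftrightarrow>
     (\<forall>b\<in>{0..c}. \<forall>z\<in>{0..c}. b \<noteq> z \<longrightarrow> W b z \<in> {0, 1} \<and> W b z + W z b = 1) \<and>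
     (\<forall>b\<in>{1..c}. W b 0 = 1) \<and>
     (\<forall>b\<in>{1..c}. \<forall>x\<in>vecs (q - 1) (c - b).
        \<Psi> b x = 1 / (real (count_list x b) + 1) * prod_list (map (W b) (filter (\<lambda>z. z \<noteq> b) x)))"

definition tau :: "nat \<Rightarrow> complex" where
  "tau N = exp (\<i> * 2 * of_real pi / of_nat N)"

definition G_par :: "nat \<Rightarrow> real \<Rightarrow> (nat \<Rightarrow> nat \<Rightarrow> real) \<Rightarrow> nat \<Rightarrow> nat \<Rightarrow> nat \<Rightarrow> complex" where
  "G_par c \<kappa> W N b a =
     (\<Sum>z | z \<in> {0..c - b} - {b} \<and> W b z = 1.
        of_real (Gamma (\<kappa> + real z)) / (tau N ^ (a * z) * fact z))"

definition v_par :: "real \<Rightarrow> nat \<Rightarrow> nat \<Rightarrow> nat \<Rightarrow> complex" where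
  "v_par \<kappa> N b a = of_real (Gamma (\<kappa> + real b)) / (tau N ^ (a * b) * fact b)"

end

theory Submission
  imports Defs
begin

text \<open>
  With \<open>g\<close> and \<open>v\<close> the parts of a weight function coming from the symbols different from \<open>b\<close> and
  from \<open>b\<close> itself, the factor \<open>1 / (\<ell> + 1)\<close> of Class 3 is absorbed by
  \<open>(q-1 choose \<ell>) / (\<ell> + 1) = (q choose \<ell> + 1) / q\<close>, so that \<open>v\<close> times the weighted sum over all
  lists of length \<open>q - 1\<close> is \<open>((g + v)^q - g^q) / q\<close>. The constraint that the entries sum
  to \<open>c - b\<close> is then imposed by averaging over the \<open>N\<close>-th roots of unity; the lower bound on \<open>N\<close>
  excludes all other sums congruent to \<open>c - b\<close> modulo \<open>N\<close>.
\<close>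

section \<open>Weighted sums over lists of fixed length\<close>

text \<open>Choose the \<open>l\<close> positions that carry \<open>b\<close>; the other
  \<open>n - l\<close> positions range freely over \<open>S - {b}\<close> and give a power. The
  induction leaves \<open>\<phi>\<close> arbitrary because prepending \<open>b\<close> replaces
  \<open>\<phi> l\<close> by \<open>\<phi> (Suc l)\<close>; the coefficients then combine by
  Pascal's rule.\<close>

lemma sum_lists_count_prod_list:
  fixes f :: "'b \<Rightarrow> 'a::comm_semiring_1"
  assumes "finite S" "b \<in> S"
  shows "(\<Sum>x | set x \<subseteq> S \<and> length x = n. \<phi> (count_list x b) * prod_list (map f x)) =
    (\<Sum>l\<le>n. of_nat (n choose l) * \<phi> l * f b ^ l * (\<Sum>z\<in>S - {b}. f z) ^ (n - l))"
proof (induction n arbitrary: \<phi>)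
  case 0
  have "{x. set x \<subseteq> S \<and> length x = 0} = {[]}"
    by auto
  then show ?case
    by simp
next
  case (Suc n)
  define L where "L = {x. set x \<subseteq> S \<and> length x = n}"
  define g where "g = (\<Sum>z\<in>S - {b}. f z)"
  have "(\<Sum>x | set x \<subseteq> S \<and> length x = Suc n. \<phi> (count_list x b) * prod_list (map f x))
      = (\<Sum>(x, z)\<in>L \<times> S. \<phi> (count_list (z # x) b) * prod_list (map f (z # x)))"
    unfolding lists_length_Suc_eq L_def
    by (subst sum.reindex) (auto simp: inj_on_def intro!: sum.cong)
  also have "\<dots> = (\<Sum>z\<in>S. \<Sum>x\<in>L. \<phi> (count_list (z # x) b) * prod_list (map f (z # x)))"
    by (simp add: sum.cartesian_product[symmetric] sum.swap[of _ S L])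
  also have "\<dots> = f b * (\<Sum>x\<in>L. \<phi> (Suc (count_list x b)) * prod_list (map f x))
      + (\<Sum>z\<in>S - {b}. f z * (\<Sum>x\<in>L. \<phi> (count_list x b) * prod_list (map f x)))"
    using assms by (simp add: sum.remove[of S b] sum_distrib_left mult_ac)
  also have "\<dots> = f b * (\<Sum>l\<le>n. of_nat (n choose l) * \<phi> (Suc l) * f b ^ l * g ^ (n - l))
      + g * (\<Sum>l\<le>n. of_nat (n choose l) * \<phi> l * f b ^ l * g ^ (n - l))"
    using Suc.IH[of \<phi>] Suc.IH[of "\<lambda>l. \<phi> (Suc l)"]
    by (simp add: L_def g_def sum_distrib_right)
  \<comment> \<open>The new term \<open>l = Suc n\<close> is zero, since
    \<open>n choose Suc n = 0\<close>. With this longer range, splitting off \<open>l = 0\<close>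
    aligns the sum with the one that has \<open>\<phi> (Suc l)\<close>.\<close>
  also have "g * (\<Sum>l\<le>n. of_nat (n choose l) * \<phi> l * f b ^ l * g ^ (n - l))
      = (\<Sum>l\<le>Suc n. of_nat (n choose l) * \<phi> l * f b ^ l * g ^ (Suc n - l))"
    by (simp add: sum_distrib_left Suc_diff_le binomial_eq_0 mult_ac)
  also have "\<dots> = \<phi> 0 * g ^ Suc n
      + (\<Sum>l\<le>n. of_nat (n choose Suc l) * \<phi> (Suc l) * f b ^ Suc l * g ^ (n - l))"
    by (subst sum.atMost_Suc_shift) simp
  also have "f b * (\<Sum>l\<le>n. of_nat (n choose l) * \<phi> (Suc l) * f b ^ l * g ^ (n - l)) + \<dots>
      = \<phi> 0 * g ^ Suc n
      + (\<Sum>l\<le>n. of_nat (Suc n choose Suc l) * \<phi> (Suc l) * f b ^ Suc l * g ^ (Suc n - Suc l))"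
    by (simp add: sum_distrib_left sum.distrib algebra_simps)
  also have "\<dots> = (\<Sum>l\<le>Suc n. of_nat (Suc n choose l) * \<phi> l * f b ^ l * g ^ (Suc n - l))"
    by (subst sum.atMost_Suc_shift) simp
  finally show ?case
    by (simp only: g_def)
qed

text \<open>Take \<open>\<phi> l = 1 / (l + 1)\<close> in the preceding identity. The factor
  \<open>f b\<close> stays on the left, so that \<open>f b = 0\<close> is no exception.\<close>

lemma sum_lists_prod_list_div_Suc_count:
  fixes f :: "'b \<Rightarrow> 'a::field_char_0"
  assumes "finite S" "b \<in> S"
  shows "of_nat (Suc n) * f b *
      (\<Sum>x | set x \<subseteq> S \<and> length x = n. prod_list (map f x) / of_nat (Suc (count_list x b))) =
    ((\<Sum>z\<in>S - {b}. f z) + f b) ^ Suc n - (\<Sum>z\<in>S - {b}. f z) ^ Suc n"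
proof -
  define g where "g = (\<Sum>z\<in>S - {b}. f z)"
  have "(\<Sum>x | set x \<subseteq> S \<and> length x = n. prod_list (map f x) / of_nat (Suc (count_list x b)))
      = (\<Sum>l\<le>n. of_nat (n choose l) * (1 / of_nat (Suc l)) * f b ^ l * g ^ (n - l))"
    using sum_lists_count_prod_list[OF assms, where \<phi> = "\<lambda>l. 1 / of_nat (Suc l)" and f = f and n = n]
    by (simp add: g_def)
  then have "of_nat (Suc n) * f b *
      (\<Sum>x | set x \<subseteq> S \<and> length x = n. prod_list (map f x) / of_nat (Suc (count_list x b)))
      = (\<Sum>l\<le>n. of_nat (Suc n) * of_nat (n choose l) / of_nat (Suc l) * f b ^ Suc l * g ^ (n - l))"
    by (simp add: sum_distrib_left mult_ac)
  also have "\<dots> = (\<Sum>l\<le>n. of_nat (Suc n choose Suc l) * f b ^ Suc l * g ^ (n - l))"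
  proof (rule sum.cong)
    fix l
    have "of_nat (Suc n) * of_nat (n choose l) = (of_nat (Suc n choose Suc l) * of_nat (Suc l) :: 'a)"
      by (simp only: Suc_times_binomial_eq flip: of_nat_mult)
    then show "of_nat (Suc n) * of_nat (n choose l) / of_nat (Suc l) * f b ^ Suc l * g ^ (n - l)
        = of_nat (Suc n choose Suc l) * f b ^ Suc l * g ^ (n - l)"
      by (simp del: of_nat_Suc binomial_Suc_Suc)
  qed simp
  \<comment> \<open>This is the binomial expansion of \<open>(f b + g) ^ Suc n\<close> without its
    term at index 0, which is \<open>g ^ Suc n\<close>.\<close>
  also have "\<dots> = (f b + g) ^ Suc n - g ^ Suc n"
    unfolding binomial_ring by (subst sum.atMost_Suc_shift) simp
  finally show ?thesis
    by (simp add: g_def add.commute)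
qed

section \<open>Selecting lists by their sum with roots of unity\<close>

lemma tau_power_eq_iff:
  assumes "N > 0"
  shows "tau N ^ j = tau N ^ k \<longleftrightarrow> j mod N = k mod N"
proof -
  have "tau N ^ i = exp (2 * of_real pi * \<i> * of_nat i / of_nat N)" for i
    by (simp add: tau_def exp_of_nat_mult[symmetric] mult_ac)
  then show ?thesis
    using complex_root_unity_eq[of N j k] assms by simp
qed

lemma tau_neq_0: "tau N \<noteq> 0"
  by (simp add: tau_def)

text \<open>Orthogonality of characters: the ratio is an \<open>N\<close>-th root of unity, and the
  geometric sum vanishes unless the ratio is 1. A quotient of powers stands for the exponent
  \<open>j - k\<close>, which would be truncated on naturals.\<close>

lemma sum_tau_powers:
  assumes "N > 0"
  shows "(\<Sum>a<N. (tau N ^ j / tau N ^ k) ^ a) = (if j mod N = k mod N then of_nat N else 0)"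
proof (cases "j mod N = k mod N")
  case True
  then show ?thesis
    using tau_power_eq_iff[OF assms, of j k] by (simp add: tau_neq_0)
next
  case False
  define r where "r = tau N ^ j / tau N ^ k"
  have "tau N ^ N = 1"
    using tau_power_eq_iff[OF assms, of N 0] by simp
  then have "r ^ N = 1"
    by (metis r_def div_by_1 mult.commute power_divide power_mult power_one)
  moreover have "r \<noteq> 1"
    using False tau_power_eq_iff[OF assms, of j k] by (simp add: r_def tau_neq_0)
  ultimately show ?thesis
    using False geometric_sum[of r N] by (simp add: r_def)
qed

lemma prod_list_map_power:
  fixes t :: "'a::comm_monoid_mult"
  shows "prod_list (map (\<lambda>z. t ^ z) x) = t ^ sum_list x"
  by (induction x) (simp_all add: power_add)

lemma prod_list_map_mult:
  fixes f g :: "'b \<Rightarrow> 'a::comm_monoid_mult"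
  shows "prod_list (map (\<lambda>z. f z * g z) x) = prod_list (map f x) * prod_list (map g x)"
  by (induction x) (simp_all add: mult_ac)

lemma sum_list_le_length_times:
  fixes x :: "nat list"
  assumes "\<And>z. z \<in> set x \<Longrightarrow> z \<le> k"
  shows "sum_list x \<le> length x * k"
  using sum_list_mono[of x "\<lambda>z. z" "\<lambda>_. k"] assms by (simp add: sum_list_triv)

text \<open>Expand each summand over lists, exchange the sums and apply orthogonality: lists with
  sum congruent to \<open>m\<close> survive, and by \<open>only\<close> their sum is
  \<open>m\<close>. The exponent is \<open>b + m\<close> because the factor \<open>v a\<close>
  contributes one further entry \<open>b\<close>.\<close>

lemma roots_of_unity_filter_lists:
  fixes f :: "nat \<Rightarrow> complex"
  assumes "finite S" "b \<in> S" "N > 0"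
    and only: "\<And>x. set x \<subseteq> S \<Longrightarrow> length x = n \<Longrightarrow> sum_list x mod N = m mod N \<Longrightarrow> sum_list x = m"
  defines "g \<equiv> \<lambda>a. \<Sum>z\<in>S - {b}. f z / tau N ^ (a * z)"
    and "v \<equiv> \<lambda>a. f b / tau N ^ (a * b)"
  shows "(\<Sum>a<N. tau N ^ (a * (b + m)) * ((g a + v a) ^ Suc n - g a ^ Suc n)) =
    of_nat (Suc n) * of_nat N * f b *
      (\<Sum>x | set x \<subseteq> S \<and> length x = n \<and> sum_list x = m.
        prod_list (map f x) / of_nat (Suc (count_list x b)))"
proof -
  define L where "L = {x. set x \<subseteq> S \<and> length x = n}"
  define h where "h x = of_nat (Suc n) * f b * prod_list (map f x) / of_nat (Suc (count_list x b))" for x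
  have fin: "finite L"
    unfolding L_def using \<open>finite S\<close> by (rule finite_lists_length_eq)
  have "tau N ^ (a * (b + m)) * ((g a + v a) ^ Suc n - g a ^ Suc n)
      = (\<Sum>x\<in>L. h x * (tau N ^ m / tau N ^ sum_list x) ^ a)" for a
  proof -
    \<comment> \<open>Twisting the weight to \<open>f z * t ^ z\<close> makes the product over a
      list \<open>x\<close> pick up exactly \<open>t ^ sum_list x\<close>.\<close>
    define t where "t = inverse (tau N ^ a)"
    have t: "f z / tau N ^ (a * z) = f z * t ^ z" for z
      by (simp add: t_def power_mult divide_inverse power_inverse)
    have ta: "tau N ^ (a * (b + m)) * t ^ b * t ^ k = (tau N ^ m / tau N ^ k) ^ a" for k
      by (simp add: t_def tau_neq_0 power_mult[symmetric] power_add power_divide field_simps)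
    have "(g a + v a) ^ Suc n - g a ^ Suc n
        = of_nat (Suc n) * (f b * t ^ b) *
          (\<Sum>x\<in>L. prod_list (map (\<lambda>z. f z * t ^ z) x) / of_nat (Suc (count_list x b)))"
      unfolding g_def v_def t L_def
      by (rule sum_lists_prod_list_div_Suc_count[OF assms(1,2), symmetric])
    also have "\<dots> = (\<Sum>x\<in>L. h x * (t ^ b * t ^ sum_list x))"
      by (simp add: sum_distrib_left h_def prod_list_map_mult prod_list_map_power mult_ac)
    finally show ?thesis
      by (simp add: sum_distrib_left ta[symmetric] mult_ac)
  qed
  then have "(\<Sum>a<N. tau N ^ (a * (b + m)) * ((g a + v a) ^ Suc n - g a ^ Suc n))
      = (\<Sum>x\<in>L. h x * (\<Sum>a<N. (tau N ^ m / tau N ^ sum_list x) ^ a))"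
    by (simp add: sum_distrib_left sum.swap[of _ L])
  also have "\<dots> = (\<Sum>x\<in>L. if sum_list x = m then h x * of_nat N else 0)"
    using only by (intro sum.cong) (auto simp: sum_tau_powers[OF \<open>N > 0\<close>] L_def)
  also have "\<dots> = (\<Sum>x | set x \<subseteq> S \<and> length x = n \<and> sum_list x = m. h x * of_nat N)"
    unfolding sum.inter_filter[OF fin, symmetric] by (simp add: L_def conj_assoc)
  also have "\<dots> = of_nat (Suc n) * of_nat N * f b *
      (\<Sum>x | set x \<subseteq> S \<and> length x = n \<and> sum_list x = m.
        prod_list (map f x) / of_nat (Suc (count_list x b)))"
    by (simp add: sum_distrib_left h_def mult_ac)
  finally show ?thesis .
qed

section \<open>Class 3 strategies as products of weights\<close>

text \<open>With values in {0, 1}, the product of the \<open>W z\<close> is the indicator that every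
  entry other than \<open>b\<close> has \<open>W z = 1\<close>, so it can be absorbed into the
  weights entry by entry.\<close>

lemma class3_weight_eq:
  fixes w :: "nat \<Rightarrow> real"
  assumes "\<And>z. z \<in> set x \<Longrightarrow> z \<noteq> b \<Longrightarrow> W z \<in> {0, 1}"
  shows "prod_list (map w x) * prod_list (map W (filter (\<lambda>z. z \<noteq> b) x)) =
    prod_list (map (\<lambda>z. if z = b \<or> W z = 1 then w z else 0) x)"
  using assms by (induction x) auto

lemma prod_list_map_divide:
  fixes f g :: "'b \<Rightarrow> 'a::field"
  shows "prod_list (map (\<lambda>z. f z / g z) x) = prod_list (map f x) / prod_list (map g x)"
  by (induction x) simp_all

text \<open>Once length and sum are fixed, the factorial and the Gamma function of the total are
  constants, and what depends on \<open>x\<close> is a product over its entries.\<close>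

lemma cond_prob_eq:
  assumes "length x = n" "sum_list x = m"
  shows "cond_prob n \<kappa> x =
    fact m / (Gamma (real m + \<kappa> * real n) * gen_Beta (replicate n \<kappa>)) *
      prod_list (map (\<lambda>z. Gamma (\<kappa> + real z) / fact z) x)"
proof -
  have "sum_list (map (\<lambda>k. \<kappa> + real k) x) = real m + \<kappa> * real n"
    using assms by (induction x arbitrary: n m) (auto simp: algebra_simps)
  then show ?thesis
    using assms
    by (simp add: cond_prob_def multinomial_def gen_Beta_def prod_list_map_divide map_map comp_def mult_ac)
qed

lemma vecs_eq_bounded_lists:
  assumes "{0..m} \<subseteq> S"
  shows "vecs n m = {x. set x \<subseteq> S \<and> length x = n \<and> sum_list x = m}"
  using assms member_le_sum_list by (fastforce simp: vecs_def)

theorem theorem3: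
  fixes q c b N :: nat and \<kappa> :: real
    and \<theta> :: "'a::finite \<Rightarrow> ('a \<Rightarrow> nat) \<Rightarrow> real"
    and W :: "nat \<Rightarrow> nat \<Rightarrow> real"
  assumes "CARD('a) = q" and "q \<ge> 2" and "c \<ge> 1" and "\<kappa> > 0"
    and "strategy c \<theta>" and "symbol_symmetric c \<theta>"
    and "class3 q c (Psi \<theta>) W"
    and "b \<in> {1..c}"
    and "int N > Max {int c - int b, \<bar>int c - int b * int q\<bar>, (int c - int b) * (int q - 2)}"
  shows "complex_of_real (K_par q c \<kappa> (Psi \<theta>) b) =
    complex_of_real (fact b * fact (c - b) /
      (real q * real N * Gamma (\<kappa> + real b) * Gamma (real (c - b) + \<kappa> * real (q - 1))
        * gen_Beta (replicate (q - 1) \<kappa>)))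
    * (\<Sum>a = 0..N - 1. tau N ^ (a * c) * ((G_par c \<kappa> W N b a + v_par \<kappa> N b a) ^ q - G_par c \<kappa> W N b a ^ q))"
proof -
  define n where "n = q - 1"
  define m where "m = c - b"
  \<comment> \<open>\<open>b\<close> may exceed \<open>m\<close>; it is inserted so that the term
    for \<open>b\<close> is always present. Lists containing such a \<open>b\<close> have too large
    a sum and are filtered out.\<close>
  define S where "S = insert b {0..m}"
  define w where "w z = Gamma (\<kappa> + real z) / fact z" for z
  define f where "f z = (if z = b \<or> W b z = 1 then w z else 0)" for z
  \<comment> \<open>Both \<open>K_par\<close> and the sum over roots of unity turn out to be
    explicit multiples of \<open>R\<close>.\<close>
  define R where "R = (\<Sum>x\<in>vecs n m. prod_list (map f x) / real (Suc (count_list x b)))"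
  have q: "q = Suc n" and c: "c = b + m"
    using assms by (auto simp: n_def m_def)
  have N: "m < N" "\<bar>int m - int b * int n\<bar> < int N" "int m * (int n - 1) < int N"
    using assms(9) by (auto simp: q c algebra_simps)
  \<comment> \<open>The sum is at most \<open>n * max b m\<close>, so it exceeds \<open>m\<close> by
    at most \<open>n * b - m\<close> or \<open>(n - 1) * m\<close>, both below \<open>N\<close> by
    the second and third bounds. As \<open>m < N\<close>, the only sum below \<open>m + N\<close>
    with residue \<open>m\<close> is \<open>m\<close> itself.\<close>
  have "sum_list x = m" if x: "set x \<subseteq> S" "length x = n" "sum_list x mod N = m mod N" for x
  proof -
    have "z \<le> max b m" if "z \<in> set x" for z
      using that x(1) by (auto simp: S_def)
    then have "sum_list x \<le> n * max b m"
      using sum_list_le_length_times[of x "max b m"] x(2) by simp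
    then have "int (sum_list x) \<le> int n * max (int b) (int m)"
      by (metis of_nat_le_iff of_nat_max of_nat_mult)
    then have "int (sum_list x) - int m < int N"
      using N by (auto simp: max_def algebra_simps split: if_splits)
    then have "sum_list x < m + N"
      by linarith
    moreover have "sum_list x mod N = m"
      using x(3) N(1) by simp
    ultimately show ?thesis
      using N(1) by (cases "sum_list x < N") (auto simp: le_mod_geq)
  qed
  moreover have "finite S" "b \<in> S" "N > 0"
    using N by (auto simp: S_def)
  ultimately have filter:
    "(\<Sum>a<N. tau N ^ (a * (b + m)) *
        (((\<Sum>z\<in>S - {b}. of_real (f z) / tau N ^ (a * z)) + of_real (f b) / tau N ^ (a * b)) ^ Suc n
          - (\<Sum>z\<in>S - {b}. of_real (f z) / tau N ^ (a * z)) ^ Suc n)) =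
      of_nat (Suc n) * of_nat N * of_real (f b) *
      (\<Sum>x | set x \<subseteq> S \<and> length x = n \<and> sum_list x = m.
        prod_list (map (\<lambda>z. of_real (f z)) x) / of_nat (Suc (count_list x b)))"
    by (intro roots_of_unity_filter_lists[where f = "\<lambda>z. of_real (f z)"])
  have prod_of_real: "prod_list (map (\<lambda>z. complex_of_real (f z)) x) = of_real (prod_list (map f x))" for x
    by (induction x) simp_all
  \<comment> \<open>The range may grow to \<open>S - {b}\<close> because \<open>f z = 0\<close>
    wherever \<open>W b z = 1\<close> fails.\<close>
  have G: "G_par c \<kappa> W N b a = (\<Sum>z\<in>S - {b}. of_real (f z) / tau N ^ (a * z))" for a
    unfolding G_par_def m_def[symmetric]
    by (rule sum.mono_neutral_cong_left) (auto simp: S_def f_def w_def mult_ac)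
  have v: "v_par \<kappa> N b a = of_real (f b) / tau N ^ (a * b)" for a
    by (simp add: v_par_def f_def w_def mult_ac)
  have "(\<Sum>a = 0..N - 1. tau N ^ (a * c) * ((G_par c \<kappa> W N b a + v_par \<kappa> N b a) ^ q - G_par c \<kappa> W N b a ^ q))
      = (\<Sum>a<N. tau N ^ (a * c) * ((G_par c \<kappa> W N b a + v_par \<kappa> N b a) ^ q - G_par c \<kappa> W N b a ^ q))"
    using \<open>N > 0\<close> by (intro sum.cong) auto
  also have "\<dots> = of_real (real q * real N * w b * R)"
  proof -
    have "vecs n m = {x. set x \<subseteq> S \<and> length x = n \<and> sum_list x = m}"
      by (rule vecs_eq_bounded_lists) (auto simp: S_def)
    moreover have "f b = w b"
      by (simp add: f_def)
    ultimately show ?thesis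
      unfolding G v filter[folded q c] by (simp add: prod_of_real R_def)
  qed
  finally have sum_eq: "(\<Sum>a = 0..N - 1. tau N ^ (a * c) *
      ((G_par c \<kappa> W N b a + v_par \<kappa> N b a) ^ q - G_par c \<kappa> W N b a ^ q))
      = of_real (real q * real N * w b * R)" .
  have "K_par q c \<kappa> (Psi \<theta>) b = fact m / (Gamma (real m + \<kappa> * real n) * gen_Beta (replicate n \<kappa>)) * R"
    unfolding K_par_def R_def sum_distrib_left n_def[symmetric] m_def[symmetric]
  proof (rule sum.cong)
    fix x assume x: "x \<in> vecs n m"
    have W: "W b z \<in> {0, 1}" if "z \<in> set x" "z \<noteq> b" for z
    proof -
      \<comment> \<open>\<open>class3\<close> controls \<open>W\<close> only on {0..c}, so the
        entries must first be bounded.\<close>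
      have "z \<le> m"
        using member_le_sum_list[OF that(1)] x by (simp add: vecs_def)
      then have "b \<in> {0..c}" "z \<in> {0..c}"
        using c by auto
      then show ?thesis
        using assms(7) that(2) by (simp add: class3_def)
    qed
    have "Psi \<theta> b x = 1 / (real (count_list x b) + 1) * prod_list (map (W b) (filter (\<lambda>z. z \<noteq> b) x))"
      using assms(7,8) x by (simp add: class3_def n_def m_def)
    moreover have "cond_prob n \<kappa> x =
        fact m / (Gamma (real m + \<kappa> * real n) * gen_Beta (replicate n \<kappa>)) * prod_list (map w x)"
      using cond_prob_eq[of x n m \<kappa>] x by (simp add: vecs_def w_def[abs_def])
    moreover have "prod_list (map w x) * prod_list (map (W b) (filter (\<lambda>z. z \<noteq> b) x)) = prod_list (map f x)"
      using class3_weight_eq[of x b "W b" w] W by (simp add: f_def[abs_def])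
    ultimately show "cond_prob n \<kappa> x * Psi \<theta> b x =
        fact m / (Gamma (real m + \<kappa> * real n) * gen_Beta (replicate n \<kappa>)) *
          (prod_list (map f x) / real (Suc (count_list x b)))"
      by (simp add: mult_ac add.commute)
  qed simp
  \<comment> \<open>Nonvanishing lets \<open>w b = Gamma (\<kappa> + real b) / fact b\<close> cancel
    against the prefactor.\<close>
  moreover have "Gamma (\<kappa> + real b) > 0"
    using \<open>\<kappa> > 0\<close> by (intro Gamma_real_pos) linarith
  ultimately have "K_par q c \<kappa> (Psi \<theta>) b = fact b * fact (c - b) /
      (real q * real N * Gamma (\<kappa> + real b) * Gamma (real (c - b) + \<kappa> * real (q - 1))
        * gen_Beta (replicate (q - 1) \<kappa>)) * (real q * real N * w b * R)"
    using \<open>N > 0\<close> q by (simp add: w_def flip: m_def n_def)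
  then show ?thesis
    unfolding sum_eq by (simp only: of_real_mult)
qed

end
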